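(* For any $0<\delta\le1/2$ there exists $\gamma(\delta)>0$ such that the following holds. Let $n>2$, let $D=(d_1,\ldots,d_n)$ be a degree sequence with $\mathcal{P}(D)\ne\emptyset$ and maximum entropy matrix $z=(\zeta_{\{j,k\}})$, and suppose $\delta\le\zeta_{\{j,k\}}\le1-\delta$ for all $j\ne k$. Consider the Gaussian probability measure on $\mathbb{R}^n$ with density proportional to $e^{-q}$, where $q(t)=\frac12\sum_{\{j,k\}}(\zeta_{\{j,k\}}-\zeta_{\{j,k\}}^2)(\tau_j+\tau_k)^2$, and regard the coordinates $\tau_1,\ldots,\tau_n$ of $t=(\tau_1,\ldots,\tau_n)$ as random variables. Then $$|\mathbf{E}\,\tau_j\tau_k|\le\frac{\gamma(\delta)}{n^2}\ \text{ for } j\ne k,\qquad \mathbf{E}\,\tau_j^2\le\frac{\gamma(\delta)}{n}\ \text{ for } j=1,\ldots,n.$$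
   Context: Coordinates of $\mathbb{R}^{\binom n2}$ are indexed by unordered pairs $\{j,k\}$, $1\le j\ne k\le n$. $\mathcal{P}(D)$ is the polytope of $x=(\xi_{\{j,k\}})$ with $\sum_{j:\,j\ne k}\xi_{\{j,k\}}=d_k$ ($k=1,\ldots,n$) and $0\le\xi_{\{j,k\}}\le1$. $H(x)=\sum_{\{j,k\}}\big(\xi_{\{j,k\}}\ln\frac1{\xi_{\{j,k\}}}+(1-\xi_{\{j,k\}})\ln\frac1{1-\xi_{\{j,k\}}}\big)$; its unique maximizer $z=(\zeta_{\{j,k\}})$ on $\mathcal{P}(D)$ is the maximum entropy matrix. For $n>2$ and all $\zeta_{\{j,k\}}\in(0,1)$, $q$ is positive definite. *)

theory Defs
  imports "HOL-Probability.Probability"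
begin

definition edges :: "nat \<Rightarrow> nat set set" where
  "edges n = {{j, k} | j k. j \<in> {1..n} \<and> k \<in> {1..n} \<and> j \<noteq> k}"

(* A point of the n-choose-2 dimensional space is an extensional function on edges n, so that
   two points agreeing in all coordinates are equal. *)
definition degree_polytope :: "nat \<Rightarrow> (nat \<Rightarrow> nat) \<Rightarrow> (nat set \<Rightarrow> real) set" where
  "degree_polytope n d =
     {x \<in> extensional (edges n).
        (\<forall>k\<in>{1..n}. (\<Sum>j\<in>{1..n} - {k}. x {j, k}) = real (d k)) \<and>
        (\<forall>e\<in>edges n. 0 \<le> x e \<and> x e \<le> 1)}"

(* At the boundary values 0 and 1 the usual convention 0 * ln (1/0) = 0 holds automatically,
   the second factor being multiplied by zero. *)
definition entropy :: "nat \<Rightarrow> (nat set \<Rightarrow> real) \<Rightarrow> real" where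
  "entropy n x = (\<Sum>e\<in>edges n. x e * ln (1 / x e) + (1 - x e) * ln (1 / (1 - x e)))"

definition max_entropy_matrix :: "nat \<Rightarrow> (nat \<Rightarrow> nat) \<Rightarrow> (nat set \<Rightarrow> real) \<Rightarrow> bool" where
  "max_entropy_matrix n d z \<longleftrightarrow> is_arg_max (entropy n) (\<lambda>x. x \<in> degree_polytope n d) z"

(* For e = {j, k} with j \<noteq> k the inner sum is t j + t k. *)
definition quad_form :: "nat \<Rightarrow> (nat set \<Rightarrow> real) \<Rightarrow> (nat \<Rightarrow> real) \<Rightarrow> real" where
  "quad_form n z t = 1 / 2 * (\<Sum>e\<in>edges n. (z e - (z e)\<^sup>2) * (\<Sum>i\<in>e. t i)\<^sup>2)"

(* The space R^n, with Lebesgue measure, is the n-fold product of lborel (functions on {1..n}),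
   since n has to be quantified after the constant in the theorem. *)
abbreviation lborel_n :: "nat \<Rightarrow> (nat \<Rightarrow> real) measure" where
  "lborel_n n \<equiv> Pi\<^sub>M {1..n} (\<lambda>_. lborel)"

definition gaussian_measure :: "nat \<Rightarrow> (nat set \<Rightarrow> real) \<Rightarrow> (nat \<Rightarrow> real) measure" where
  "gaussian_measure n z =
     density (lborel_n n)
       (\<lambda>t. ennreal (exp (- quad_form n z t) / (LINT s|lborel_n n. exp (- quad_form n z s))))"

text \<open>Sanity checks: when all coordinates of \<open>z\<close> lie strictly between 0 and 1 and \<open>n > 2\<close>,
  this is a probability measure with finite second moments, so the Bochner integrals
  of the products of coordinates are genuine expectations.\<close>

lemma finite_edges: "finite (edges n)"
  by (rule finite_subset[of _ "Pow {1..n}"]) (auto simp: edges_def)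

lemma edge_subset: "e \<in> edges n \<Longrightarrow> e \<subseteq> {1..n}"
  by (auto simp: edges_def)

lemma measurable_coordinate:
  assumes "i \<in> {1..n}" shows "(\<lambda>t. t i) \<in> borel_measurable (lborel_n n)"
  using measurable_component_singleton[OF assms, of "\<lambda>_. lborel :: real measure"]
  by simp

lemma measurable_quad_form [measurable]: "quad_form n z \<in> borel_measurable (lborel_n n)"
  unfolding quad_form_def
  by (intro borel_measurable_times borel_measurable_const borel_measurable_sum
      borel_measurable_power measurable_coordinate) (erule subsetD[OF edge_subset])

lemma quad_form_coercive:
  assumes n: "n > 2" and z: "\<And>e. e \<in> edges n \<Longrightarrow> 0 < z e \<and> z e < 1"
  shows "\<exists>c>0. \<forall>t. c * (\<Sum>i\<in>{1..n}. (t i)\<^sup>2) \<le> quad_form n z t"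
proof -
  have edgeI: "{j, k} \<in> edges n" if "j \<in> {1..n}" "k \<in> {1..n}" "j \<noteq> k" for j k
    using that unfolding edges_def by blast
  have e12: "{1, 2} \<in> edges n" using n by (intro edgeI) auto
  define a where "a = Min ((\<lambda>e. z e - (z e)\<^sup>2) ` edges n)"
  have "z e - (z e)\<^sup>2 > 0" if "e \<in> edges n" for e
  proof -
    have "z e * (1 - z e) > 0" using z[OF that] by simp
    then show ?thesis by (simp add: algebra_simps power2_eq_square)
  qed
  then have a: "a > 0" unfolding a_def using finite_edges e12 by (subst Min_gr_iff) auto
  have ale: "a \<le> z e - (z e)\<^sup>2" if "e \<in> edges n" for e
    unfolding a_def using finite_edges that by auto
  define c where "c = 2 * a / (9 * n)"
  have "c * (\<Sum>i\<in>{1..n}. (t i)\<^sup>2) \<le> quad_form n z t" for t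
  proof -
    define S where "S = (\<Sum>e\<in>edges n. (\<Sum>i\<in>e. t i)\<^sup>2)"
    have le: "(t j + t k)\<^sup>2 \<le> S" if "j \<in> {1..n}" "k \<in> {1..n}" "j \<noteq> k" for j k
    proof -
      have "(\<Sum>i\<in>{j, k}. t i)\<^sup>2 \<le> S"
        unfolding S_def by (rule member_le_sum[OF edgeI[OF that]]) (use finite_edges in auto)
      then show ?thesis using that by simp
    qed
    have sq: "(t i)\<^sup>2 \<le> 9 / 4 * S" if i: "i \<in> {1..n}" for i
    proof -
      have "\<exists>j\<in>{1..n}. \<exists>k\<in>{1..n}. i \<noteq> j \<and> i \<noteq> k \<and> j \<noteq> k"
      proof -
        consider "i = 1" | "i = 2" | "i \<noteq> 1" "i \<noteq> 2" by blast
        then show ?thesis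
        proof cases
          case 1 then show ?thesis using n by (intro bexI[of _ 2] bexI[of _ 3]) auto
        next
          case 2 then show ?thesis using n by (intro bexI[of _ 1] bexI[of _ 3]) auto
        next
          case 3 then show ?thesis using n by (intro bexI[of _ 1] bexI[of _ 2]) auto
        qed
      qed
      then obtain j k where jk: "j \<in> {1..n}" "k \<in> {1..n}" "i \<noteq> j" "i \<noteq> k" "j \<noteq> k" by blast
      define u v w where uvw: "u = t i + t j" "v = t i + t k" "w = t j + t k"
      have "4 * (t i)\<^sup>2 = (u + v - w)\<^sup>2" by (simp add: uvw power2_eq_square algebra_simps)
      also have "\<dots> \<le> 3 * (u\<^sup>2 + v\<^sup>2 + w\<^sup>2)"
        using zero_le_power2[of "u - v"] zero_le_power2[of "u + w"] zero_le_power2[of "v + w"]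
        by (simp add: power2_eq_square algebra_simps)
      also have "\<dots> \<le> 9 * S"
        using le[OF i jk(1,3)] le[OF i jk(2,4)] le[OF jk(1,2,5)] by (simp add: uvw)
      finally show ?thesis by simp
    qed
    have "(\<Sum>i\<in>{1..n}. (t i)\<^sup>2) \<le> (\<Sum>i\<in>{1..n}. 9 / 4 * S)" by (rule sum_mono[OF sq])
    then have *: "(\<Sum>i\<in>{1..n}. (t i)\<^sup>2) \<le> 9 / 4 * n * S" by simp
    have "c * (\<Sum>i\<in>{1..n}. (t i)\<^sup>2) \<le> c * (9 / 4 * n * S)"
      using a by (intro mult_left_mono *) (simp add: c_def)
    also have "\<dots> = 1 / 2 * (a * S)" using n by (simp add: c_def field_simps)
    also have "\<dots> \<le> quad_form n z t"
      unfolding quad_form_def S_def sum_distrib_left[of a]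
      by (intro mult_left_mono sum_mono mult_right_mono ale) auto
    finally show ?thesis .
  qed
  moreover have "c > 0" using a n by (simp add: c_def)
  ultimately show ?thesis by blast
qed

lemma integrable_exp_sum_squares:
  assumes c: "c > (0::real)"
  shows "integrable (lborel_n n) (\<lambda>t. exp (- c * (\<Sum>i\<in>{1..n}. (t i)\<^sup>2)))"
proof -
  interpret product_sigma_finite "\<lambda>_::nat. lborel :: real measure" by standard
  have "integrable lborel (\<lambda>x::real. exp (- c * x\<^sup>2))"
  proof -
    define s where "s = 1 / sqrt (2 * c)"
    have s: "s > 0" "2 * s\<^sup>2 = 1 / c" using c by (auto simp: s_def power_divide)
    have "(\<lambda>x. exp (- c * x\<^sup>2)) = (\<lambda>x. sqrt (2 * pi * s\<^sup>2) * normal_density 0 s x)"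
      using s c by (auto simp: normal_density_def mult.commute)
    moreover have "integrable lborel (\<lambda>x. sqrt (2 * pi * s\<^sup>2) * normal_density 0 s x)"
      using integrable_normal_density[OF s(1)] by (intro integrable_mult_right) auto
    ultimately show ?thesis by simp
  qed
  then have "integrable (lborel_n n) (\<lambda>t. \<Prod>i\<in>{1..n}. exp (- c * (t i)\<^sup>2))"
    by (intro product_integrable_prod) auto
  then show ?thesis by (simp add: exp_sum[symmetric] sum_distrib_left sum_negf)
qed

lemma
  assumes n: "n > 2" and z: "\<And>e. e \<in> edges n \<Longrightarrow> 0 < z e \<and> z e < 1"
  shows prob_space_gaussian_measure: "prob_space (gaussian_measure n z)"
    and integrable_gaussian_measure:
      "j \<in> {1..n} \<Longrightarrow> k \<in> {1..n} \<Longrightarrow> integrable (gaussian_measure n z) (\<lambda>t. t j * t k)"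
proof -
  interpret product_sigma_finite "\<lambda>_::nat. lborel :: real measure" by standard
  let ?L = "lborel_n n" and ?q = "quad_form n z"
  obtain c where c: "c > 0" and cq: "\<And>t. c * (\<Sum>i\<in>{1..n}. (t i)\<^sup>2) \<le> ?q t"
    using quad_form_coercive[of n z, OF n z] by blast
  define Z where "Z = (LINT s|?L. exp (- ?q s))"
  have int: "integrable ?L (\<lambda>t. exp (- ?q t))"
    by (rule Bochner_Integration.integrable_bound[OF integrable_exp_sum_squares[OF c]]) (use cq in \<open>auto simp del: One_nat_def\<close>)
  have Z: "Z > 0"
  proof -
    have "Z \<noteq> 0"
    proof
      assume "Z = 0"
      then have "AE t in ?L. exp (- ?q t) = 0"
        using integral_nonneg_eq_0_iff_AE[OF int] by (simp add: Z_def)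
      then have "AE t in ?L. False" by simp
      then have "emeasure ?L (space ?L) = 0"
        by (simp add: AE_iff_measurable[OF sets.top] del: One_nat_def)
      moreover have "emeasure ?L (space ?L) = (\<Prod>i\<in>{1..n}. emeasure lborel (UNIV :: real set))"
        unfolding space_PiM by (subst emeasure_PiM) auto
      ultimately show False by simp
    qed
    moreover have "Z \<ge> 0" unfolding Z_def by (rule Bochner_Integration.integral_nonneg) auto
    ultimately show ?thesis by simp
  qed
  have gm: "gaussian_measure n z = density ?L (\<lambda>t. ennreal (exp (- ?q t) / Z))"
    by (simp add: gaussian_measure_def Z_def)
  show "prob_space (gaussian_measure n z)"
  proof
    have "emeasure (gaussian_measure n z) (space (gaussian_measure n z))
        = (\<integral>\<^sup>+ t. ennreal (exp (- ?q t) / Z) \<partial>?L)"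
      unfolding gm by (subst emeasure_density) (auto simp del: One_nat_def intro!: nn_integral_cong)
    also have "\<dots> = ennreal (LINT t|?L. exp (- ?q t) / Z)"
      using int Z by (intro nn_integral_eq_integral) auto
    also have "\<dots> = 1" using Z by (simp add: Z_def)
    finally show "emeasure (gaussian_measure n z) (space (gaussian_measure n z)) = 1" .
  qed
  assume jk: "j \<in> {1..n}" "k \<in> {1..n}"
  have [measurable]: "(\<lambda>t. t j) \<in> borel_measurable ?L" "(\<lambda>t. t k) \<in> borel_measurable ?L"
    using jk by (auto intro!: measurable_coordinate simp del: One_nat_def)
  have bound: "\<bar>exp (- ?q t) / Z * (t j * t k)\<bar>
      \<le> 2 / (c * Z) * exp (- (c / 2) * (\<Sum>i\<in>{1..n}. (t i)\<^sup>2))" for t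
  proof -
    define R where "R = (\<Sum>i\<in>{1..n}. (t i)\<^sup>2)"
    have "(t i)\<^sup>2 \<le> R" if "i \<in> {1..n}" for i
      unfolding R_def using that by (intro member_le_sum) auto
    from this[OF jk(1)] this[OF jk(2)] have "\<bar>t j * t k\<bar> \<le> R"
      using zero_le_power2[of "\<bar>t j\<bar> - \<bar>t k\<bar>"] by (simp add: power2_diff abs_mult)
    moreover have "R \<le> 2 / c * exp (c / 2 * R)"
    proof -
      have "c / 2 * R \<le> exp (c / 2 * R)" using exp_ge_add_one_self[of "c / 2 * R"] by linarith
      then show ?thesis using c by (simp add: field_simps)
    qed
    ultimately have "exp (- ?q t) * \<bar>t j * t k\<bar> \<le> exp (- (c * R)) * (2 / c * exp (c / 2 * R))"
      using cq[of t] by (intro mult_mono) (auto simp: R_def)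
    also have "\<dots> = 2 / c * exp (- (c / 2) * R)"
      by (simp add: exp_add[symmetric])
    finally show ?thesis using Z by (simp add: abs_mult R_def field_simps)
  qed
  have "integrable ?L (\<lambda>t. 2 / (c * Z) * exp (- (c / 2) * (\<Sum>i\<in>{1..n}. (t i)\<^sup>2)))"
    by (intro integrable_mult_right integrable_exp_sum_squares) (use c in simp)
  then have "integrable ?L (\<lambda>t. exp (- ?q t) / Z * (t j * t k))"
  proof (rule Bochner_Integration.integrable_bound)
    show "(\<lambda>t. exp (- ?q t) / Z * (t j * t k)) \<in> borel_measurable ?L" by measurable
    show "AE t in ?L. norm (exp (- ?q t) / Z * (t j * t k))
        \<le> norm (2 / (c * Z) * exp (- (c / 2) * (\<Sum>i\<in>{1..n}. (t i)\<^sup>2)))"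
      unfolding real_norm_def by (intro AE_I2 order_trans[OF bound abs_ge_self])
  qed
  then show "integrable (gaussian_measure n z) (\<lambda>t. t j * t k)"
    unfolding gm using Z by (subst integrable_density) (auto simp del: One_nat_def)
qed

end

theory Submission
  imports Defs
begin

text \<open>The gradient of \<open>q\<close> at \<open>t\<close> is \<open>B t\<close>, where \<open>B\<close> is the signless Laplacian of the complete graph with
  edge weights \<open>\<zeta> - \<zeta>\<^sup>2 \<in> [\<delta> (1 - \<delta>), 1/4]\<close>. Integrating by parts in one coordinate shows that the
  covariance matrix is the inverse of \<open>B\<close>, so everything reduces to bounding a solution \<open>x\<close> of
  \<open>B x = e\<^sub>k\<close>. Comparison with the unweighted graph gives \<open>\<langle>y, B y\<rangle> \<ge> a (n - 2) |y|\<^sup>2\<close> with \<open>a = \<delta> (1 - \<delta>)\<close>;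
  for \<open>y = x\<close> this yields \<open>x\<^sub>k = O(1/n)\<close>, and for \<open>y\<close> obtained from \<open>x\<close> by deleting the coordinate \<open>k\<close>
  it yields an \<open>O(1/n)\<close> bound on the \<open>\<ell>\<^sub>1\<close>-norm of \<open>y\<close>. Row \<open>j \<noteq> k\<close> of the equation, whose diagonal entry
  is of order \<open>n\<close>, then gives \<open>x\<^sub>j = O(1/n\<^sup>2)\<close>.\<close>

section \<open>Quadratic form and inverse of a weighted signless Laplacian\<close>

lemma sum_offdiag_swap:
  fixes f :: "'a \<Rightarrow> 'a \<Rightarrow> 'b::comm_monoid_add"
  assumes "finite V"
  shows "(\<Sum>j\<in>V. \<Sum>l\<in>V - {j}. f j l) = (\<Sum>j\<in>V. \<Sum>l\<in>V - {j}. f l j)"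
proof -
  have "(\<Sum>j\<in>V. \<Sum>l\<in>V - {j}. f j l) = (\<Sum>j\<in>V. \<Sum>l\<in>{l. l \<in> V \<and> j \<noteq> l}. f j l)"
    by (intro sum.cong) auto
  also have "\<dots> = (\<Sum>l\<in>V. \<Sum>j\<in>{j. j \<in> V \<and> j \<noteq> l}. f j l)"
    using assms by (rule sum.swap_restrict[OF _ assms])
  also have "\<dots> = (\<Sum>j\<in>V. \<Sum>l\<in>V - {j}. f l j)"
    by (intro sum.cong) auto
  finally show ?thesis .
qed

text \<open>Degree matrix plus adjacency matrix of the weighted graph, applied to \<open>y\<close>.
  Removing \<open>j\<close> from the range keeps loop values such as \<open>z {j, j} = z {j}\<close>
  out of the sum.\<close>

definition signless_laplacian :: "'a set \<Rightarrow> ('a \<Rightarrow> 'a \<Rightarrow> real) \<Rightarrow> ('a \<Rightarrow> real) \<Rightarrow> 'a \<Rightarrow> real" where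
  "signless_laplacian V w y j = (\<Sum>l\<in>V - {j}. w j l * (y j + y l))"

text \<open>Twice the form is the sum of \<open>w j l * (y j + y l)^2\<close> over ordered pairs,
  hence monotone in the weights. For unit weights the form equals \<open>(N - 2) * |y|^2\<close>
  plus the square of the sum of \<open>y\<close>, where \<open>N = card V\<close>; that square is
  dropped.\<close>

lemma signless_laplacian_form_ge:
  fixes w :: "'a \<Rightarrow> 'a \<Rightarrow> real"
  assumes V: "finite V" and sym: "\<And>j l. w j l = w l j"
    and ge: "\<And>j l. j \<in> V \<Longrightarrow> l \<in> V \<Longrightarrow> j \<noteq> l \<Longrightarrow> a \<le> w j l" and a: "0 \<le> a"
  shows "a * (real (card V) - 2) * (\<Sum>j\<in>V. (y j)\<^sup>2) \<le> (\<Sum>j\<in>V. y j * signless_laplacian V w y j)"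
proof -
  have form: "(\<Sum>j\<in>V. y j * signless_laplacian V w y j) = (\<Sum>j\<in>V. \<Sum>l\<in>V - {j}. y j * w j l * (y j + y l))"
    by (simp add: signless_laplacian_def sum_distrib_left mult.assoc)
  \<comment> \<open>Adding this copy, with the roles of \<open>j\<close> and \<open>l\<close>
    exchanged, to \<open>form\<close> completes the square \<open>(y j + y l)^2\<close>.\<close>
  then have form_swap: "(\<Sum>j\<in>V. y j * signless_laplacian V w y j) = (\<Sum>j\<in>V. \<Sum>l\<in>V - {j}. y l * w j l * (y j + y l))"
    unfolding sum_offdiag_swap[OF V, of "\<lambda>j l. y j * w j l * (y j + y l)"]
    by (simp add: sym add.commute)
  have "2 * (\<Sum>j\<in>V. y j * signless_laplacian V w y j) = (\<Sum>j\<in>V. \<Sum>l\<in>V - {j}. w j l * (y j + y l)\<^sup>2)"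
    unfolding mult_2 by (subst form, subst form_swap)
      (simp only: sum.distrib[symmetric], simp add: power2_eq_square algebra_simps)
  also have "\<dots> \<ge> (\<Sum>j\<in>V. \<Sum>l\<in>V - {j}. a * (y j + y l)\<^sup>2)"
    by (intro sum_mono mult_right_mono ge) auto
  \<comment> \<open>The range is completed by \<open>l = j\<close>, whose term
    \<open>(2 * y j)^2\<close> is subtracted again.\<close>
  also have "(\<Sum>j\<in>V. \<Sum>l\<in>V - {j}. a * (y j + y l)\<^sup>2)
      = a * (\<Sum>j\<in>V. (\<Sum>l\<in>V. (y j + y l)\<^sup>2) - 4 * (y j)\<^sup>2)"
    unfolding sum_distrib_left[symmetric] using V
    by (intro arg_cong2[where f = "(*)"] sum.cong refl) (auto simp: sum_diff1 power2_eq_square)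
  also have "(\<Sum>j\<in>V. (\<Sum>l\<in>V. (y j + y l)\<^sup>2) - 4 * (y j)\<^sup>2)
      = 2 * (real (card V) - 2) * (\<Sum>j\<in>V. (y j)\<^sup>2) + 2 * (\<Sum>j\<in>V. y j)\<^sup>2"
    by (simp add: power2_sum sum.distrib sum_subtractf sum_distrib_left[symmetric] sum_distrib_right[symmetric] algebra_simps)
       (simp add: power2_eq_square sum_distrib_left sum_distrib_right algebra_simps)
  finally have "a * (2 * (real (card V) - 2) * (\<Sum>j\<in>V. (y j)\<^sup>2)) + 2 * (a * (\<Sum>j\<in>V. y j)\<^sup>2)
      \<le> 2 * (\<Sum>j\<in>V. y j * signless_laplacian V w y j)" by (simp add: algebra_simps)
  moreover have "0 \<le> a * (\<Sum>j\<in>V. y j)\<^sup>2" using a by simp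
  ultimately show ?thesis by (simp add: algebra_simps)
qed

text \<open>Here \<open>x\<close> is column \<open>k\<close> of the inverse matrix. The diagonal
  entry is bounded first, since the bound on the other entries is proportional to it.\<close>

lemma signless_laplacian_inverse_bounds:
  fixes w :: "'a \<Rightarrow> 'a \<Rightarrow> real"
  assumes V: "finite V" "2 < card V" and sym: "\<And>j l. w j l = w l j"
    and ge: "\<And>j l. j \<in> V \<Longrightarrow> l \<in> V \<Longrightarrow> j \<noteq> l \<Longrightarrow> a \<le> w j l" and a: "0 < a"
    and le: "\<And>j l. j \<in> V \<Longrightarrow> l \<in> V \<Longrightarrow> j \<noteq> l \<Longrightarrow> w j l \<le> b"
    and k: "k \<in> V" and x: "\<And>j. j \<in> V \<Longrightarrow> signless_laplacian V w x j = (if j = k then 1 else 0)"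
  shows "x k \<le> 3 / (a * card V)"
    and "\<And>j. j \<in> V \<Longrightarrow> j \<noteq> k \<Longrightarrow> \<bar>x j\<bar> \<le> 6 * b * (1 + 3 * b / a) / (a * card V)\<^sup>2"
proof -
  define N where "N = real (card V)"
  have N: "3 \<le> N" using V(2) by (simp add: N_def)
  \<comment> \<open>Source of the factor 3 in the constants: three or more vertices allow
    \<open>N - 2\<close> to be replaced by \<open>N / 3\<close>.\<close>
  have N3: "N \<le> 3 * (N - 2)" using N by simp
  have b: "0 < b"
  proof -
    have "\<not> V \<subseteq> {k}" using V(2) card_mono[of "{k}" V] by auto
    then obtain l where "l \<in> V" "l \<noteq> k" by blast
    then show ?thesis using ge[of l k] le[of l k] a k by auto
  qed
  have form: "a * N * (\<Sum>j\<in>V. (y j)\<^sup>2) \<le> 3 * (\<Sum>j\<in>V. y j * signless_laplacian V w y j)" for y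
  proof -
    have "a * N * (\<Sum>j\<in>V. (y j)\<^sup>2) \<le> a * (3 * (N - 2)) * (\<Sum>j\<in>V. (y j)\<^sup>2)"
      using a N3 by (intro mult_right_mono mult_left_mono sum_nonneg) auto
    also have "\<dots> \<le> 3 * (\<Sum>j\<in>V. y j * signless_laplacian V w y j)"
      using signless_laplacian_form_ge[of V w a y, OF V(1) sym ge] a by (simp add: N_def algebra_simps)
    finally show ?thesis .
  qed
  have "(\<Sum>j\<in>V. x j * signless_laplacian V w x j) = (\<Sum>j\<in>V. if j = k then x j else 0)"
    by (intro sum.cong) (auto simp: x)
  also have "\<dots> = x k" using V k by simp
  finally have *: "a * N * (\<Sum>j\<in>V. (x j)\<^sup>2) \<le> 3 * x k" using form[of x] by simp
  have "(x k)\<^sup>2 \<le> (\<Sum>j\<in>V. (x j)\<^sup>2)" using V k by (intro member_le_sum) auto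
  then have "a * N * (x k)\<^sup>2 \<le> a * N * (\<Sum>j\<in>V. (x j)\<^sup>2)" using a N by (intro mult_left_mono) auto
  with * have sq: "a * N * (x k)\<^sup>2 \<le> 3 * x k" by simp
  have xk0: "0 \<le> x k"
  proof -
    have "0 \<le> a * N * (x k)\<^sup>2" using a N by (intro mult_nonneg_nonneg) auto
    with sq show ?thesis by linarith
  qed
  have xk: "a * N * x k \<le> 3"
  proof (cases "x k = 0")
    case False
    then have "x k > 0" using xk0 by simp
    moreover have "(a * N * x k) * x k \<le> 3 * x k" using sq by (simp add: power2_eq_square)
    ultimately show ?thesis by simp
  qed simp
  then show "x k \<le> 3 / (a * card V)" using a N by (simp add: N_def field_simps)
  \<comment> \<open>At \<open>k\<close> the vector \<open>y\<close> vanishes, and in every other row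
    the equation for \<open>x\<close> leaves only the deleted term, so the form at \<open>y\<close>
    is controlled by \<open>x k\<close>.\<close>
  define y where "y = x(k := 0)"
  have L: "signless_laplacian V w y j = - w j k * x k" if "j \<in> V" "j \<noteq> k" for j
  proof -
    have "signless_laplacian V w x j - signless_laplacian V w y j = (\<Sum>l\<in>V - {j}. if l = k then w j k * x k else 0)"
      unfolding signless_laplacian_def sum_subtractf[symmetric] using that
      by (intro sum.cong) (auto simp: y_def algebra_simps)
    also have "\<dots> = w j k * x k" using V k that by simp
    finally show ?thesis using x[OF that(1)] that by simp
  qed
  define Y where "Y = (\<Sum>j\<in>V. \<bar>y j\<bar>)"
  have Y0: "0 \<le> Y" by (simp add: Y_def sum_nonneg)
  have "(\<Sum>j\<in>V. y j * signless_laplacian V w y j) \<le> (\<Sum>j\<in>V. \<bar>y j\<bar> * (b * x k))"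
  proof (rule sum_mono)
    fix j assume j: "j \<in> V"
    show "y j * signless_laplacian V w y j \<le> \<bar>y j\<bar> * (b * x k)"
    proof (cases "j = k")
      case False
      have "- (y j) * (w j k * x k) \<le> \<bar>y j\<bar> * (b * x k)"
        using ge[OF j k False] le[OF j k False] a xk0 by (intro mult_mono mult_right_mono) auto
      then show ?thesis using L[OF j False] by simp
    qed (simp add: y_def)
  qed
  also have "\<dots> = Y * (b * x k)" by (simp add: Y_def sum_distrib_right)
  finally have **: "a * N * (\<Sum>j\<in>V. (y j)\<^sup>2) \<le> 3 * (Y * (b * x k))" using form[of y] by simp
  \<comment> \<open>Cauchy-Schwarz. Its factor \<open>N\<close> matches the one in the lower bound
    for the form, so \<open>Y\<close> has the same order as \<open>x k\<close>.\<close>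
  have "Y\<^sup>2 \<le> (\<Sum>j\<in>V. \<bar>y j\<bar>\<^sup>2) * N"
    unfolding Y_def N_def using sum_squared_le_sum_of_squares[of "\<lambda>j. \<bar>y j\<bar>" V] by (simp add: mult.commute)
  then have "a * Y\<^sup>2 \<le> a * ((\<Sum>j\<in>V. (y j)\<^sup>2) * N)" using a by (intro mult_left_mono) auto
  with ** have "(a * Y) * Y \<le> (3 * b * x k) * Y" by (simp add: power2_eq_square algebra_simps)
  then have "a * Y \<le> 3 * b * x k"
  proof (cases "Y = 0")
    case False
    with Y0 have "Y > 0" by simp
    then show ?thesis using \<open>(a * Y) * Y \<le> (3 * b * x k) * Y\<close> by (simp only: mult_le_cancel_right_pos)
  qed (use b xk0 in simp)
  then have Yle: "Y \<le> 3 * b / a * x k" using a by (simp add: field_simps)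
  fix j assume j: "j \<in> V" "j \<noteq> k"
  \<comment> \<open>The diagonal entry of row \<open>j\<close>; it is at least
    \<open>a * (N - 1)\<close>, hence at least \<open>a * N / 2\<close>.\<close>
  define D where "D = (\<Sum>l\<in>V - {j}. w j l)"
  have "a * (N - 1) = (\<Sum>l\<in>V - {j}. a)" using j V by (simp add: N_def of_nat_diff)
  also have "\<dots> \<le> D" unfolding D_def using j by (intro sum_mono ge) auto
  finally have "a * (N - 1) \<le> D" .
  moreover have "a * N \<le> 2 * (a * (N - 1))" using a N by simp
  ultimately have D: "a * N \<le> 2 * D" by simp
  have "D * x j = - (\<Sum>l\<in>V - {j}. w j l * x l)"
    using x[OF j(1)] j(2) by (simp add: signless_laplacian_def D_def distrib_left sum.distrib sum_distrib_right)
  then have "\<bar>D * x j\<bar> = \<bar>\<Sum>l\<in>V - {j}. w j l * x l\<bar>" by simp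
  moreover have "0 < a * N" using a N by simp
  ultimately have "D * \<bar>x j\<bar> = \<bar>\<Sum>l\<in>V - {j}. w j l * x l\<bar>" using D by (simp add: abs_mult)
  also have "\<dots> \<le> (\<Sum>l\<in>V - {j}. \<bar>w j l * x l\<bar>)" by (rule sum_abs)
  also have "\<dots> \<le> (\<Sum>l\<in>V - {j}. b * \<bar>x l\<bar>)"
    unfolding abs_mult
  proof (intro sum_mono mult_right_mono)
    fix l assume "l \<in> V - {j}"
    then show "\<bar>w j l\<bar> \<le> b" using ge[of j l] le[of j l] j a by auto
  qed auto
  also have "\<dots> \<le> (\<Sum>l\<in>V. b * \<bar>x l\<bar>)" using V b by (intro sum_mono2) auto
  also have "\<dots> = b * (x k + Y)"
  proof -
    have "Y = (\<Sum>l\<in>V - {k}. \<bar>x l\<bar>)"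
      unfolding Y_def sum.remove[OF V(1) k] by (simp add: y_def)
    then show ?thesis
      unfolding sum_distrib_left[symmetric] sum.remove[OF V(1) k] using xk0 by simp
  qed
  also have "\<dots> \<le> b * ((1 + 3 * b / a) * x k)" using Yle b by (intro mult_left_mono) (auto simp: algebra_simps)
  finally have "(a * N) * \<bar>x j\<bar> \<le> 2 * (b * (1 + 3 * b / a) * x k)"
    using mult_right_mono[OF D, of "\<bar>x j\<bar>"] by simp
  \<comment> \<open>A second factor \<open>a * N\<close> is paired with \<open>x k\<close> in order
    to use \<open>xk\<close>; this produces the order \<open>1 / N^2\<close>.\<close>
  then have "(a * N) * ((a * N) * \<bar>x j\<bar>) \<le> (a * N) * (2 * (b * (1 + 3 * b / a) * x k))"
    using a N by (intro mult_left_mono) auto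
  also have "\<dots> = 2 * b * (1 + 3 * b / a) * (a * N * x k)" by (simp add: algebra_simps)
  also have "\<dots> \<le> 2 * b * (1 + 3 * b / a) * 3" using xk a b by (intro mult_left_mono) auto
  finally have "(a * N)\<^sup>2 * \<bar>x j\<bar> \<le> 6 * b * (1 + 3 * b / a)" by (simp add: power2_eq_square algebra_simps)
  moreover have "0 < (a * N)\<^sup>2" using a N by simp
  ultimately show "\<bar>x j\<bar> \<le> 6 * b * (1 + 3 * b / a) / (a * card V)\<^sup>2"
    unfolding N_def[symmetric] by (simp only: pos_le_divide_eq mult.commute[of "\<bar>x j\<bar>"])
qed


section \<open>Integration by parts for the Gaussian density\<close>

text \<open>With \<open>p\<close> the quadratic polynomial in the exponent, the integrands are minus
  the derivatives of \<open>exp (- p)\<close> and \<open>y * exp (- p)\<close>. The proof uses the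
  moments of order 0, 1 and 2 of a normal density instead of boundary terms.\<close>

lemma
  fixes A b c :: real
  assumes A: "0 < A"
  shows integral_gaussian_deriv: "(LBINT y. (A * y + b) * exp (- (A / 2 * y\<^sup>2 + b * y + c))) = 0"
    and integral_gaussian_times_deriv:
      "(LBINT y. (y * (A * y + b) - 1) * exp (- (A / 2 * y\<^sup>2 + b * y + c))) = 0"
proof -
  \<comment> \<open>Completing the square: mean \<open>- b / A\<close>, variance
    \<open>1 / A\<close>, and \<open>K\<close> collects the constant of the exponent and the
    normalization.\<close>
  define \<mu> \<sigma> K where "\<mu> = - b / A" and "\<sigma> = 1 / sqrt A"
    and "K = exp (b\<^sup>2 / (2 * A) - c) * sqrt (2 * pi * \<sigma>\<^sup>2)"
  have \<sigma>: "0 < \<sigma>" "\<sigma>\<^sup>2 = 1 / A" using A by (auto simp: \<sigma>_def power_divide)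
  have E: "exp (- (A / 2 * y\<^sup>2 + b * y + c)) = K * normal_density \<mu> \<sigma> y" for y
  proof -
    have "- (A / 2 * y\<^sup>2 + b * y + c) = (b\<^sup>2 / (2 * A) - c) + - (y - \<mu>)\<^sup>2 / (2 * \<sigma>\<^sup>2)"
      using A unfolding \<sigma>(2) \<mu>_def by (simp add: field_simps power2_eq_square)
    then have "exp (- (A / 2 * y\<^sup>2 + b * y + c)) = exp (b\<^sup>2 / (2 * A) - c) * exp (- (y - \<mu>)\<^sup>2 / (2 * \<sigma>\<^sup>2))"
      by (metis exp_add)
    moreover have "sqrt (2 * pi * \<sigma>\<^sup>2) \<noteq> 0" using \<sigma> A by simp
    ultimately show ?thesis by (simp add: K_def normal_density_def)
  qed
  have lin: "A * y + b = A * (y - \<mu>)" for y using A by (simp add: \<mu>_def field_simps)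
  have m1: "has_bochner_integral lborel (\<lambda>y. normal_density \<mu> \<sigma> y * (y - \<mu>)) 0"
    using normal_moment_odd[OF \<sigma>(1), of \<mu> 0] by simp
  have m2: "has_bochner_integral lborel (\<lambda>y. normal_density \<mu> \<sigma> y * (y - \<mu>)\<^sup>2) (1 / A)"
    using normal_moment_even[OF \<sigma>(1), of \<mu> 1] \<sigma> by simp
  have m0: "has_bochner_integral lborel (normal_density \<mu> \<sigma>) 1"
    using normal_moment_even[OF \<sigma>(1), of \<mu> 0] by simp
  have "(\<lambda>y. (A * y + b) * exp (- (A / 2 * y\<^sup>2 + b * y + c)))
      = (\<lambda>y. (K * A) * (normal_density \<mu> \<sigma> y * (y - \<mu>)))"
    unfolding E lin by (simp add: algebra_simps)
  then show "(LBINT y. (A * y + b) * exp (- (A / 2 * y\<^sup>2 + b * y + c))) = 0"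
    using has_bochner_integral_mult_right[OF m1, of "K * A"] by (auto simp: has_bochner_integral_iff)
  \<comment> \<open>Writing \<open>y\<close> as \<open>(y - \<mu>) + \<mu>\<close> reduces the
    integrand to centred moments.\<close>
  have "(\<lambda>y. (y * (A * y + b) - 1) * exp (- (A / 2 * y\<^sup>2 + b * y + c)))
      = (\<lambda>y. (K * A) * (normal_density \<mu> \<sigma> y * (y - \<mu>)\<^sup>2)
          + (K * A * \<mu>) * (normal_density \<mu> \<sigma> y * (y - \<mu>)) - K * normal_density \<mu> \<sigma> y)"
    unfolding E lin by (intro ext) (simp add: algebra_simps power2_eq_square)
  moreover have "has_bochner_integral lborel (\<lambda>y. (K * A) * (normal_density \<mu> \<sigma> y * (y - \<mu>)\<^sup>2)
          + (K * A * \<mu>) * (normal_density \<mu> \<sigma> y * (y - \<mu>)) - K * normal_density \<mu> \<sigma> y)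
        ((K * A) * (1 / A) + (K * A * \<mu>) * 0 - K * 1)"
    by (intro has_bochner_integral_add has_bochner_integral_diff has_bochner_integral_mult_right m0 m1 m2)
  ultimately show "(LBINT y. (y * (A * y + b) - 1) * exp (- (A / 2 * y\<^sup>2 + b * y + c))) = 0"
    using A by (simp add: has_bochner_integral_iff)
qed

text \<open>Edges through \<open>j\<close> give the terms in \<open>y\<close>, all other edges only
  a constant. The coefficients are arranged so that the derivative in \<open>y\<close> is row
  \<open>j\<close> of the signless Laplacian at \<open>t(j := y)\<close>.\<close>

lemma quad_form_fun_upd:
  fixes z :: "nat set \<Rightarrow> real"
  assumes j: "j \<in> {1..n}"
  defines "w \<equiv> \<lambda>l. z {j, l} - (z {j, l})\<^sup>2"
  shows "\<exists>c. \<forall>y. quad_form n z (t(j := y))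
    = (\<Sum>l\<in>{1..n} - {j}. w l) / 2 * y\<^sup>2 + (\<Sum>l\<in>{1..n} - {j}. w l * t l) * y + c"
proof (intro exI allI)
  fix y
  define S where "S = {e \<in> edges n. j \<in> e}"
  define R where "R = {e \<in> edges n. j \<notin> e}"
  let ?f = "\<lambda>s e. (z e - (z e)\<^sup>2) * (\<Sum>i\<in>e. s i)\<^sup>2"
  have S: "S = (\<lambda>l. {j, l}) ` ({1..n} - {j})" unfolding S_def edges_def using j by (auto 0 4 simp: doubleton_eq_iff simp del: atLeastAtMost_iff)
  have inj: "inj_on (\<lambda>l. {j, l}) ({1..n} - {j})" by (auto simp: inj_on_def doubleton_eq_iff)
  have "(\<Sum>e\<in>edges n. ?f (t(j := y)) e) = (\<Sum>e\<in>S. ?f (t(j := y)) e) + (\<Sum>e\<in>R. ?f (t(j := y)) e)"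
    using finite_edges[of n] by (subst sum.union_disjoint[symmetric]) (auto simp: S_def R_def intro!: sum.cong)
  moreover have "(\<Sum>e\<in>R. ?f (t(j := y)) e) = (\<Sum>e\<in>R. ?f t e)"
    by (intro sum.cong arg_cong2[where f = "(*)"] arg_cong[where f = "\<lambda>x. x\<^sup>2"]) (auto simp: R_def)
  moreover have "(\<Sum>e\<in>S. ?f (t(j := y)) e) = (\<Sum>l\<in>{1..n} - {j}. w l * (y + t l)\<^sup>2)"
    unfolding S sum.reindex[OF inj] by (intro sum.cong) (auto simp: w_def)
  moreover have "(\<Sum>l\<in>{1..n} - {j}. w l * (y + t l)\<^sup>2) = (\<Sum>l\<in>{1..n} - {j}. w l) * y\<^sup>2
      + 2 * (\<Sum>l\<in>{1..n} - {j}. w l * t l) * y + (\<Sum>l\<in>{1..n} - {j}. w l * (t l)\<^sup>2)"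
    unfolding sum_distrib_left sum_distrib_right sum.distrib[symmetric]
    by (intro sum.cong) (auto simp: power2_eq_square algebra_simps)
  ultimately show "quad_form n z (t(j := y))
    = (\<Sum>l\<in>{1..n} - {j}. w l) / 2 * y\<^sup>2 + (\<Sum>l\<in>{1..n} - {j}. w l * t l) * y
      + 1 / 2 * ((\<Sum>l\<in>{1..n} - {j}. w l * (t l)\<^sup>2) + (\<Sum>e\<in>R. ?f t e))"
    by (simp add: quad_form_def algebra_simps)
qed

section \<open>The covariance matrix as an inverse\<close>

text \<open>By linearity the left side is the expectation of \<open>g t j * t k\<close>, where
  \<open>g t\<close> is the gradient of \<open>q\<close> at \<open>t\<close>; integrating by parts
  in coordinate \<open>j\<close> evaluates it.\<close>

lemma gaussian_covariance_inverse:
  assumes n: "n > 2" and z: "\<And>e. e \<in> edges n \<Longrightarrow> 0 < z e \<and> z e < 1"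
    and j: "j \<in> {1..n}" and k: "k \<in> {1..n}"
  shows "signless_laplacian {1..n} (\<lambda>j l. z {j, l} - (z {j, l})\<^sup>2)
    (\<lambda>l. LINT t|gaussian_measure n z. t l * t k) j = (if j = k then 1 else 0)"
proof -
  interpret product_sigma_finite "\<lambda>_::nat. lborel :: real measure" by standard
  interpret G: prob_space "gaussian_measure n z" by (rule prob_space_gaussian_measure[OF n z])
  let ?L = "lborel_n n" and ?q = "quad_form n z"
  define Z where "Z = (LINT s|?L. exp (- ?q s))"
  define w where "w = (\<lambda>j l. z {j, l} - (z {j, l})\<^sup>2)"
  define g where "g = signless_laplacian {1..n} w"
  \<comment> \<open>Subtracting \<open>r\<close> under the integral makes
    \<open>exp (- q) * (g t j * t k - r)\<close> minus the derivative of
    \<open>t k * exp (- q)\<close> in coordinate \<open>j\<close>.\<close>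
  define r :: real where "r = (if j = k then 1 else 0)"
  have gm: "gaussian_measure n z = density ?L (\<lambda>t. ennreal (exp (- ?q t) / Z))"
    by (simp add: gaussian_measure_def Z_def)
  \<comment> \<open>Division by zero yields 0, so \<open>Z = 0\<close> would make the density
    vanish, against total mass 1.\<close>
  have "Z \<noteq> 0"
  proof
    assume "Z = 0"
    then have "emeasure (gaussian_measure n z) (space (gaussian_measure n z)) = 0"
      unfolding gm by (simp add: emeasure_density del: One_nat_def)
    then show False using G.emeasure_space_1 by simp
  qed
  moreover have "Z \<ge> 0" unfolding Z_def by (rule Bochner_Integration.integral_nonneg) auto
  ultimately have Z: "Z > 0" by simp
  note int2 = integrable_gaussian_measure[OF n z _ k]
  have gk: "g t j * t k = (\<Sum>l\<in>{1..n} - {j}. w j l * (t j * t k + t l * t k))" for t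
    unfolding g_def signless_laplacian_def sum_distrib_right by (simp add: distrib_right mult.assoc)
  have "(\<Sum>l\<in>{1..n} - {j}. w j l * ((LINT t|gaussian_measure n z. t j * t k) + (LINT t|gaussian_measure n z. t l * t k)))
      = (LINT t|gaussian_measure n z. (\<Sum>l\<in>{1..n} - {j}. w j l * (t j * t k + t l * t k)))"
    using j int2 by (subst Bochner_Integration.integral_sum) (auto simp del: One_nat_def)
  also have "\<dots> = (LINT t|gaussian_measure n z. g t j * t k)"
    by (simp add: gk del: One_nat_def)
  finally have lhs: "g (\<lambda>l. LINT t|gaussian_measure n z. t l * t k) j = (LINT t|gaussian_measure n z. g t j * t k)"
    by (simp add: g_def signless_laplacian_def del: One_nat_def)
  have intG: "integrable (gaussian_measure n z) (\<lambda>t. g t j * t k - r)"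
  proof -
    have "integrable (gaussian_measure n z) (\<lambda>t. (\<Sum>l\<in>{1..n} - {j}. w j l * (t j * t k + t l * t k)) - r)"
      using j by (intro Bochner_Integration.integrable_diff Bochner_Integration.integrable_sum 
         integrable_mult_right Bochner_Integration.integrable_add int2) auto
    then show ?thesis by (simp add: gk del: One_nat_def)
  qed
  then have meas: "(\<lambda>t. g t j * t k - r) \<in> borel_measurable ?L"
    unfolding gm by (simp add: integrable_iff_bounded del: One_nat_def)
  have "integrable ?L (\<lambda>t. exp (- ?q t) / Z * (g t j * t k - r))"
    using intG meas Z unfolding gm by (subst (asm) integrable_density) (auto simp del: One_nat_def)
  then have intL: "integrable ?L (\<lambda>t. exp (- ?q t) * (g t j * t k - r))"
    using integrable_mult_right[of Z ?L "\<lambda>t. exp (- ?q t) / Z * (g t j * t k - r)"] Z by simp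
  define I where "I = {1..n} - {j}"
  have I: "finite I" "j \<notin> I" "{1..n} = insert j I" using j by (auto simp: I_def)
  define A where "A = (\<Sum>l\<in>I. w j l)"
  have A: "A > 0" unfolding A_def
  proof (rule sum_pos)
    have "\<not> {1..n} \<subseteq> {j}" using n card_mono[of "{j}" "{1..n}"] by auto
    then show "I \<noteq> {}" unfolding I_def by blast
    fix l assume l: "l \<in> I"
    then have "{j, l} \<in> edges n" using j unfolding edges_def I_def by blast
    then have "0 < z {j, l} * (1 - z {j, l})" using z by simp
    then show "0 < w j l" by (simp add: w_def algebra_simps power2_eq_square)
  qed (rule I)
  \<comment> \<open>On a line in direction \<open>j\<close> the weight is a one-variable Gaussian
    and \<open>g\<close> is the derivative of its exponent. For \<open>j = k\<close> the factor
    \<open>t k\<close> varies along the line, otherwise it is a constant and comes out.\<close>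
  have inner: "(LBINT y. exp (- ?q (x(j := y))) * (g (x(j := y)) j * (x(j := y)) k - r)) = 0" for x
  proof -
    define b where "b = (\<Sum>l\<in>I. w j l * x l)"
    obtain c where c: "\<And>y. ?q (x(j := y)) = A / 2 * y\<^sup>2 + b * y + c"
      using quad_form_fun_upd[OF j, of z x] unfolding A_def b_def w_def I_def by blast
    have g: "g (x(j := y)) j = A * y + b" for y
    proof -
      have "g (x(j := y)) j = (\<Sum>l\<in>I. w j l * y + w j l * x l)"
        unfolding g_def signless_laplacian_def I_def[symmetric]
        using I(2) by (intro sum.cong) (auto simp: algebra_simps)
      then show ?thesis by (simp add: sum.distrib A_def b_def sum_distrib_right)
    qed
    show ?thesis
    proof (cases "j = k")
      case True
      then show ?thesis using integral_gaussian_times_deriv[OF A, of b c] unfolding c g by (simp add: r_def mult.commute)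
    next
      case False
      then have "(\<lambda>y. exp (- ?q (x(j := y))) * (g (x(j := y)) j * (x(j := y)) k - r))
        = (\<lambda>y. x k * ((A * y + b) * exp (- (A / 2 * y\<^sup>2 + b * y + c))))"
        unfolding c g by (simp add: r_def algebra_simps)
      then show ?thesis using integral_gaussian_deriv[OF A, of b c] by simp
    qed
  qed
  \<comment> \<open>Fubini, with coordinate \<open>j\<close> integrated first.\<close>
  have "(LINT t|?L. exp (- ?q t) * (g t j * t k - r)) = 0"
    using product_integral_insert[OF I(1,2) intL[unfolded I(3)]] unfolding I(3) inner by simp
  then have "(LINT t|gaussian_measure n z. g t j * t k - r) = 0"
    unfolding gm using meas Z by (subst integral_density) (auto simp del: One_nat_def)
  moreover have "(LINT t|gaussian_measure n z. g t j * t k - r) = (LINT t|gaussian_measure n z. g t j * t k) - r"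
  proof -
    have "integrable (gaussian_measure n z) (\<lambda>t. (g t j * t k - r) + r)"
      by (intro Bochner_Integration.integrable_add intG) simp
    then show ?thesis by (simp add: G.prob_space)
  qed
  ultimately show ?thesis using lhs by (simp add: g_def w_def r_def)
qed

section \<open>The constant depending on \<open>\<delta>\<close> alone\<close>

theorem theorem4p1:
  fixes \<delta> :: real
  assumes "0 < \<delta>" and "\<delta> \<le> 1 / 2"
  shows "\<exists>\<gamma>::real. \<gamma> > 0 \<and>
    (\<forall>(n::nat) (d::nat \<Rightarrow> nat) (z::nat set \<Rightarrow> real).
      n > 2 \<longrightarrow> degree_polytope n d \<noteq> {} \<longrightarrow> max_entropy_matrix n d z \<longrightarrow>
      (\<forall>j\<in>{1..n}. \<forall>k\<in>{1..n}. j \<noteq> k \<longrightarrow> \<delta> \<le> z {j, k} \<and> z {j, k} \<le> 1 - \<delta>) \<longrightarrow>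
      (\<forall>j\<in>{1..n}. \<forall>k\<in>{1..n}. j \<noteq> k \<longrightarrow>
         \<bar>LINT t|gaussian_measure n z. t j * t k\<bar> \<le> \<gamma> / (real n)\<^sup>2) \<and>
      (\<forall>j\<in>{1..n}. (LINT t|gaussian_measure n z. (t j)\<^sup>2) \<le> \<gamma> / real n))"
proof -
  define a where "a = \<delta> * (1 - \<delta>)"
  \<comment> \<open>The off-diagonal bound for weights between \<open>a\<close> and
    \<open>1 / 4\<close>, with the factor \<open>1 / n^2\<close> taken out. The diagonal bound
    contributes \<open>3 / a\<close>, and the sum of both serves as the witness.\<close>
  define C where "C = 6 * (1 / 4) * (1 + 3 * (1 / 4) / a) / a\<^sup>2"
  have a: "0 < a" using assms by (simp add: a_def)
  then have C: "0 < C" by (simp add: C_def add_pos_pos)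
  show ?thesis
  proof (intro exI[of _ "3 / a + C"] conjI allI impI)
    show "0 < 3 / a + C" using a C by (simp add: add_pos_pos)
    fix n :: nat and d :: "nat \<Rightarrow> nat" and z :: "nat set \<Rightarrow> real"
    assume n: "2 < n" and zb: "\<forall>j\<in>{1..n}. \<forall>k\<in>{1..n}. j \<noteq> k \<longrightarrow> \<delta> \<le> z {j, k} \<and> z {j, k} \<le> 1 - \<delta>"
    define w where "w = (\<lambda>j l. z {j, l} - (z {j, l})\<^sup>2)"
    have z01: "0 < z e \<and> z e < 1" if "e \<in> edges n" for e
      using that zb assms unfolding edges_def by fastforce
    have sym: "w j l = w l j" for j l by (simp add: w_def insert_commute)
    have ge: "a \<le> w j l" if "j \<in> {1..n}" "l \<in> {1..n}" "j \<noteq> l" for j l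
    proof -
      \<comment> \<open>This product expands to \<open>w j l - a\<close>.\<close>
      have "0 \<le> (z {j, l} - \<delta>) * (1 - \<delta> - z {j, l})" using zb that by (intro mult_nonneg_nonneg) auto
      then show ?thesis by (simp add: a_def w_def power2_eq_square algebra_simps)
    qed
    have le: "w j l \<le> 1 / 4" for j l
      using zero_le_power2[of "z {j, l} - 1 / 2"] by (simp add: w_def power2_eq_square algebra_simps)
    have card: "2 < card {1..n}" using n by simp
    note bounds = signless_laplacian_inverse_bounds[of "{1..n}" w a "1 / 4", OF finite_atLeastAtMost card sym ge a le]
    have inv: "signless_laplacian {1..n} w (\<lambda>l. LINT t|gaussian_measure n z. t l * t k) j
        = (if j = k then 1 else 0)" if "j \<in> {1..n}" "k \<in> {1..n}" for j k
      unfolding w_def by (rule gaussian_covariance_inverse[OF n z01 that])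
    have N: "0 < real n" using n by simp
    show "\<forall>j\<in>{1..n}. (LINT t|gaussian_measure n z. (t j)\<^sup>2) \<le> (3 / a + C) / real n"
    proof
      fix j assume j: "j \<in> {1..n}"
      have "(LINT t|gaussian_measure n z. (t j)\<^sup>2) \<le> 3 / (a * real n)"
        using bounds(1)[OF _ _ _ j inv[OF _ j]] by (simp add: power2_eq_square)
      also have "\<dots> = 3 / a / real n" by simp
      also have "\<dots> \<le> (3 / a + C) / real n" using C N by (intro divide_right_mono) auto
      finally show "(LINT t|gaussian_measure n z. (t j)\<^sup>2) \<le> (3 / a + C) / real n" .
    qed
    show "\<forall>j\<in>{1..n}. \<forall>k\<in>{1..n}. j \<noteq> k \<longrightarrow>
        \<bar>LINT t|gaussian_measure n z. t j * t k\<bar> \<le> (3 / a + C) / (real n)\<^sup>2"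
    proof (intro ballI impI)
      fix j k assume jk: "j \<in> {1..n}" "k \<in> {1..n}" "j \<noteq> k"
      have "\<bar>LINT t|gaussian_measure n z. t j * t k\<bar>
          \<le> 6 * (1 / 4) * (1 + 3 * (1 / 4) / a) / (a * real n)\<^sup>2"
        using bounds(2)[OF _ _ _ jk(2) inv[OF _ jk(2)] jk(1,3)] by simp
      also have "\<dots> = C / (real n)\<^sup>2" by (simp add: C_def power_mult_distrib)
      also have "\<dots> \<le> (3 / a + C) / (real n)\<^sup>2" using a by (intro divide_right_mono) auto
      finally show "\<bar>LINT t|gaussian_measure n z. t j * t k\<bar> \<le> (3 / a + C) / (real n)\<^sup>2" .
    qed
  qed
qed

end
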